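(* Let $X\subset\mathbb{R}^d$ and $Y\subset\mathbb{R}$ be non-empty closed sets, let $a:Y\to[0,\infty)$ be measurable and $p\in[0,\infty)$. Let $L:Y\times\mathbb{R}\to[0,\infty)$ be a loss function of type $(a,p)$, let $\mathrm{P}$ be a probability distribution on $X\times Y$ with $|\mathrm{P}|_a<\infty$, and let $f:X\to\mathbb{R}$ be a function with $f\in L_p(\mathrm{P})$. Then $\mathcal{R}_{L,\mathrm{P}}(f)<\infty$.
   Context: A loss function is a measurable $L:Y\times\mathbb{R}\to[0,\infty)$. It is of type $(a,p)$ if there is a constant $c>0$ with $L(y,t)\le c(a(y)+|t|^p+1)$ for all $y\in Y$, $t\in\mathbb{R}$. $|\mathrm{P}|_a:=\int_{X\times Y}a(y)\,d\mathrm{P}(x,y)$. $\mathcal{R}_{L,\mathrm{P}}(f):=\mathbb{E}_{\mathrm{P}}L(Y,f(X))$ with $(X,Y)\sim\mathrm{P}$. $f\in L_p(\mathrm{P})$ means that $f$ is measurable with $\mathbb{E}_{\mathrm{P}}|f(X)|^p<\infty$. *)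

theory Defs
  imports "HOL-Probability.Probability"
begin

(* Functions on a subset such as X, Y or Y x R are total HOL functions whose values outside
   that subset are never used. Integrals of nonnegative functions take values in the type
   ennreal, so that finiteness is a genuine claim. *)

(* |t|^p for p >= 0 with the convention 0^0 = 1, whereas 0 powr 0 = 0. *)
definition abs_pow :: "real \<Rightarrow> real \<Rightarrow> real" where
  "abs_pow t p = (if p = 0 then 1 else \<bar>t\<bar> powr p)"

definition prob_distribution_on ::
    "'a::topological_space set \<Rightarrow> real set \<Rightarrow> ('a \<times> real) measure \<Rightarrow> bool" where
  "prob_distribution_on X Y P \<longleftrightarrow>
     prob_space P \<and> sets P = sets (restrict_space borel X \<Otimes>\<^sub>M restrict_space borel Y)"

definition loss_function :: "real set \<Rightarrow> (real \<Rightarrow> real \<Rightarrow> real) \<Rightarrow> bool" where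
  "loss_function Y L \<longleftrightarrow>
     (\<lambda>(y, t). L y t) \<in> borel_measurable (restrict_space borel Y \<Otimes>\<^sub>M borel) \<and>
     (\<forall>y\<in>Y. \<forall>t. 0 \<le> L y t)"

definition loss_of_type ::
    "real set \<Rightarrow> (real \<Rightarrow> real \<Rightarrow> real) \<Rightarrow> (real \<Rightarrow> real) \<Rightarrow> real \<Rightarrow> bool" where
  "loss_of_type Y L a p \<longleftrightarrow>
     (\<exists>c>0. \<forall>y\<in>Y. \<forall>t. L y t \<le> c * (a y + abs_pow t p + 1))"

definition a_moment :: "('a \<times> real) measure \<Rightarrow> (real \<Rightarrow> real) \<Rightarrow> ennreal" where
  "a_moment P a = (\<integral>\<^sup>+(x, y). ennreal (a y) \<partial>P)"

definition risk ::
    "(real \<Rightarrow> real \<Rightarrow> real) \<Rightarrow> ('a \<times> real) measure \<Rightarrow> ('a \<Rightarrow> real) \<Rightarrow> ennreal" where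
  "risk L P f = (\<integral>\<^sup>+(x, y). ennreal (L y (f x)) \<partial>P)"

definition Lp_functions ::
    "'a::topological_space set \<Rightarrow> ('a \<times> real) measure \<Rightarrow> real \<Rightarrow> ('a \<Rightarrow> real) set" where
  "Lp_functions X P p =
     {f \<in> borel_measurable (restrict_space borel X).
        (\<integral>\<^sup>+(x, y). ennreal (abs_pow (f x) p) \<partial>P) < \<infinity>}"

end

theory Submission
  imports Defs
begin

text \<open>Put t = f(x) into the growth bound of the loss and integrate. By monotonicity and
  linearity of the integral, the risk is at most c (|P|_a + E|f(X)|^p + 1), where the final 1 is the
  total mass of P. The first two terms are finite by the moment condition and by membership of f in
  L_p. The whole estimate takes place in \<open>ennreal\<close>, so finiteness is only read off at
  the end.\<close>

theorem proposition6:
  fixes X :: "(real ^ 'd) set" and Y :: "real set"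
    and a :: "real \<Rightarrow> real" and p :: real
    and L :: "real \<Rightarrow> real \<Rightarrow> real"
    and P :: "((real ^ 'd) \<times> real) measure"
    and f :: "real ^ 'd \<Rightarrow> real"
  assumes "X \<noteq> {}" and "closed X"
    and "Y \<noteq> {}" and "closed Y"
    and "a \<in> borel_measurable (restrict_space borel Y)" and "\<forall>y\<in>Y. 0 \<le> a y"
    and "0 \<le> p"
    and "loss_function Y L" and "loss_of_type Y L a p"
    and "prob_distribution_on X Y P"
    and "a_moment P a < \<infinity>"
    and "f \<in> Lp_functions X P p"
  shows "risk L P f < \<infinity>"
proof -
  let ?A = "\<lambda>(x :: real ^ 'd, y). ennreal (a y)"
    and ?F = "\<lambda>(x, y :: real). ennreal (abs_pow (f x) p)"
  obtain c where c: "c > 0"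
    and bound: "\<And>y t. y \<in> Y \<Longrightarrow> L y t \<le> c * (a y + abs_pow t p + 1)"
    using assms(9) unfolding loss_of_type_def by blast
  interpret prob_space P
    using assms(10) unfolding prob_distribution_on_def by blast
  have sets_P [measurable_cong]: "sets P = sets (restrict_space borel X \<Otimes>\<^sub>M restrict_space borel Y)"
    using assms(10) unfolding prob_distribution_on_def by blast
  \<comment> \<open>The growth bound and the sign of \<open>a\<close> are known only on Y, so the
    integrands may be compared only at points whose second coordinate lies in Y.\<close>
  have space_P: "space P = X \<times> Y"
    using sets_eq_imp_space_eq[OF sets_P] by (simp add: space_pair_measure space_restrict_space)
  have [measurable]: "a \<in> borel_measurable (restrict_space borel Y)"
      "f \<in> borel_measurable (restrict_space borel X)"
    using assms(5,12) unfolding Lp_functions_def by auto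
  have [measurable]: "(\<lambda>t. abs_pow t p) \<in> borel_measurable borel"
    unfolding abs_pow_def by measurable
  \<comment> \<open>Needed to split the integral of the dominating function into its
    summands.\<close>
  have [measurable]: "?A \<in> borel_measurable P" "?F \<in> borel_measurable P"
    by measurable
  have pow_nonneg: "0 \<le> abs_pow t p" for t
    by (simp add: abs_pow_def)
  have "risk L P f \<le> (\<integral>\<^sup>+z. ennreal c * (?A z + ?F z + 1) \<partial>P)"
    unfolding risk_def
  proof (rule nn_integral_mono, clarify)
    fix x y assume "(x, y) \<in> space P"
    then have y: "y \<in> Y" by (simp add: space_P)
    have "ennreal (L y (f x)) \<le> ennreal (c * (a y + abs_pow (f x) p + 1))"
      using bound[OF y] by (rule ennreal_leI)
    \<comment> \<open>\<open>ennreal\<close> sends negative reals to 0, hence it is additive and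
      multiplicative here only because c and all summands are nonnegative.\<close>
    also have "\<dots> = ennreal c * (ennreal (a y) + ennreal (abs_pow (f x) p) + 1)"
      using y c assms(6) pow_nonneg by (simp add: ennreal_mult ennreal_plus flip: ennreal_1)
    finally show "ennreal (L y (f x)) \<le> ennreal c * (ennreal (a y) + ennreal (abs_pow (f x) p) + 1)" .
  qed
  \<comment> \<open>The constant 1 integrates to 1 because P is a probability measure.\<close>
  also have "\<dots> = ennreal c * (a_moment P a + (\<integral>\<^sup>+z. ?F z \<partial>P) + 1)"
    by (simp add: nn_integral_cmult nn_integral_add emeasure_space_1 a_moment_def)
  also have "\<dots> < \<infinity>"
    using assms(11,12) by (simp add: Lp_functions_def ennreal_mult_less_top)
  finally show ?thesis .
qed

end
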